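(* Let $0<\alpha<1$, let $\Delta_2=[a_1,b_1]\times[a_2,b_2]\subset\mathbb{R}^2$, and let $f,g,\eta\in C^1(\Delta_2)$. For $i=1,2$ let $P_{t_i}=\langle a_i,t_i,b_i,p_i,q_i\rangle$ be a parameter set with $p_i,q_i\in\mathbb{R}$, and let $P_{t_i}^*=\langle a_i,t_i,b_i,q_i,p_i\rangle$ be its dual. Let $k_{1-\alpha}$ be a difference kernel, i.e. $k_{1-\alpha}(t_i,\tau)=k_{1-\alpha}(t_i-\tau)$, such that $k_{1-\alpha}\in L_1([0,b_i-a_i])$ for $i=1,2$, and suppose that $K_{P_{t_1}^*}^{1-\alpha}g,\;K_{P_{t_2}^*}^{1-\alpha}f\in C^1(\Delta_2)$. Then, writing $\mathbf{t}=(t_1,t_2)$, $$\int_{a_1}^{b_1}\int_{a_2}^{b_2}\left[g(\mathbf{t})\left(B_{P_{t_1}}^{\alpha}\eta\right)(\mathbf{t})+f(\mathbf{t})\left(B_{P_{t_2}}^{\alpha}\eta\right)(\mathbf{t})\right]dt_2\,dt_1$$ $$=-\int_{a_1}^{b_1}\int_{a_2}^{b_2}\eta(\mathbf{t})\left[\left(A_{P_{t_1}^*}^{\alpha}g\right)(\mathbf{t})+\left(A_{P_{t_2}^*}^{\alpha}f\right)(\mathbf{t})\right]dt_2\,dt_1+\oint_{\partial\Delta_2}\eta(\mathbf{t})\left[\left(K_{P_{t_1}^*}^{1-\alpha}g\right)(\mathbf{t})\,dt_2-\left(K_{P_{t_2}^*}^{1-\alpha}f\right)(\mathbf{t})\,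dt_1\right].$$
   Context: All functions are real-valued and $a_i<b_i$ for $i=1,2$. $C^1(\Delta_2)$ denotes the continuously differentiable functions on the closed rectangle $\Delta_2$. The line integral over $\partial\Delta_2$ is taken in the usual positive (counterclockwise) orientation of the $(t_1,t_2)$-plane. A kernel $k_{1-\alpha}(t,\tau)$ is a real function which may depend on $\alpha$; it is a difference kernel if $k_{1-\alpha}(t,\tau)=k_{1-\alpha}(t-\tau)$ for a function $k_{1-\alpha}$ of one variable (only evaluated at nonnegative arguments below). Generalized partial fractional integrals: for a parameter set $P_{t_i}=\langle a_i,t_i,b_i,p_i,q_i\rangle$ and $h$ continuous on $\Delta_2$, $$\left(K_{P_{t_1}}^{1-\alpha}h\right)(t_1,t_2):=p_1\int_{a_1}^{t_1}k_{1-\alpha}(t_1-\tau)h(\tau,t_2)\,d\tau+q_1\int_{t_1}^{b_1}k_{1-\alpha}(\tau-t_1)h(\tau,t_2)\,d\tau,$$ $$\left(K_{P_{t_2}}^{1-\alpha}h\right)(t_1,t_2):=p_2\int_{a_2}^{t_2}k_{1-\alpha}(t_2-\tau)h(t_1,\tau)\,d\tau+q_2\int_{t_2}^{b_2}k_{1-\alpha}(\tau-t_2)h(t_1,\tau)\,d\tau.$$ The operators for the dual parameter set $P_{t_i}^*=\langle a_i,t_i,b_i,q_i,p_i\rangle$ are given by the same formulas with $p_i$ and $q_i$ interchanged. Generalized partial Riemann--Liouville derivative (for any parameter set $P_{t_i}$, defined when $K_{P_{t_i}}^{1-\alpha}h\in C^1(\Delta_2)$): $A_{P_{t_i}}^{\alpha}h:=\frac{\partial}{\partial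 t_i}\left(K_{P_{t_i}}^{1-\alpha}h\right)$. Generalized partial Caputo derivative (defined for $h\in C^1(\Delta_2)$): $B_{P_{t_i}}^{\alpha}h:=K_{P_{t_i}}^{1-\alpha}\left(\frac{\partial h}{\partial t_i}\right)$. *)

theory Defs
  imports "HOL-Analysis.Analysis"
begin

text \<open>A parameter set \<open>\<langle>a, t, b, p, q\<rangle>\<close>; the variable \<open>t\<close> is not stored, since it is the
  argument at which the operators below are evaluated.\<close>

datatype param_set =
  Param (lower: real) (upper: real) (wleft: real) (wright: real)

definition dual :: "param_set \<Rightarrow> param_set" where
  "dual P = Param (lower P) (upper P) (wright P) (wleft P)"

text \<open>Derivatives are taken relative to \<open>S\<close>, hence are one-sided at the boundary of a
  closed rectangle, where they are still unique.\<close>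

definition C1_on :: "(real \<times> real) set \<Rightarrow> (real \<times> real \<Rightarrow> real) \<Rightarrow> bool" where
  "C1_on S h \<longleftrightarrow>
     (\<exists>D :: real \<times> real \<Rightarrow> (real \<times> real) \<Rightarrow>\<^sub>L real.
        (\<forall>x\<in>S. (h has_derivative blinfun_apply (D x)) (at x within S)) \<and> continuous_on S D)"

definition partial1 :: "real \<Rightarrow> real \<Rightarrow> (real \<times> real \<Rightarrow> real) \<Rightarrow> real \<times> real \<Rightarrow> real" where
  "partial1 a b h = (\<lambda>(t1, t2). vector_derivative (\<lambda>s. h (s, t2)) (at t1 within {a..b}))"

definition partial2 :: "real \<Rightarrow> real \<Rightarrow> (real \<times> real \<Rightarrow> real) \<Rightarrow> real \<times> real \<Rightarrow> real" where
  "partial2 a b h = (\<lambda>(t1, t2). vector_derivative (\<lambda>s. h (t1, s)) (at t2 within {a..b}))"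

text \<open>In the fractional integrals \<open>K\<close>, the Riemann--Liouville derivatives \<open>A\<close>
  and the Caputo derivatives \<open>B\<close> below, \<open>k \<beta>\<close> is the one-variable function of a difference kernel
  with index \<open>\<beta>\<close>, i.e. \<open>k\<^sub>\<beta>(t, \<tau>) = k \<beta> (t - \<tau>)\<close>. The gauge integral agrees with
  the Lebesgue integral whenever the integrand is absolutely integrable, as it is for an
  \<open>L\<^sub>1\<close> kernel and continuous \<open>h\<close>.\<close>

definition K1 :: "(real \<Rightarrow> real \<Rightarrow> real) \<Rightarrow> real \<Rightarrow> param_set \<Rightarrow>
    (real \<times> real \<Rightarrow> real) \<Rightarrow> real \<times> real \<Rightarrow> real" where
  "K1 k \<beta> P h = (\<lambda>(t1, t2).
      wleft P * integral {lower P..t1} (\<lambda>\<tau>. k \<beta> (t1 - \<tau>) * h (\<tau>, t2))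
    + wright P * integral {t1..upper P} (\<lambda>\<tau>. k \<beta> (\<tau> - t1) * h (\<tau>, t2)))"

definition K2 :: "(real \<Rightarrow> real \<Rightarrow> real) \<Rightarrow> real \<Rightarrow> param_set \<Rightarrow>
    (real \<times> real \<Rightarrow> real) \<Rightarrow> real \<times> real \<Rightarrow> real" where
  "K2 k \<beta> P h = (\<lambda>(t1, t2).
      wleft P * integral {lower P..t2} (\<lambda>\<tau>. k \<beta> (t2 - \<tau>) * h (t1, \<tau>))
    + wright P * integral {t2..upper P} (\<lambda>\<tau>. k \<beta> (\<tau> - t2) * h (t1, \<tau>)))"

definition A1 :: "(real \<Rightarrow> real \<Rightarrow> real) \<Rightarrow> real \<Rightarrow> param_set \<Rightarrow>
    (real \<times> real \<Rightarrow> real) \<Rightarrow> real \<times> real \<Rightarrow> real" where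
  "A1 k \<alpha> P h = partial1 (lower P) (upper P) (K1 k (1 - \<alpha>) P h)"

definition A2 :: "(real \<Rightarrow> real \<Rightarrow> real) \<Rightarrow> real \<Rightarrow> param_set \<Rightarrow>
    (real \<times> real \<Rightarrow> real) \<Rightarrow> real \<times> real \<Rightarrow> real" where
  "A2 k \<alpha> P h = partial2 (lower P) (upper P) (K2 k (1 - \<alpha>) P h)"

definition B1 :: "(real \<Rightarrow> real \<Rightarrow> real) \<Rightarrow> real \<Rightarrow> param_set \<Rightarrow>
    (real \<times> real \<Rightarrow> real) \<Rightarrow> real \<times> real \<Rightarrow> real" where
  "B1 k \<alpha> P h = K1 k (1 - \<alpha>) P (partial1 (lower P) (upper P) h)"

definition B2 :: "(real \<Rightarrow> real \<Rightarrow> real) \<Rightarrow> real \<Rightarrow> param_set \<Rightarrow>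
    (real \<times> real \<Rightarrow> real) \<Rightarrow> real \<times> real \<Rightarrow> real" where
  "B2 k \<alpha> P h = K2 k (1 - \<alpha>) P (partial2 (lower P) (upper P) h)"

text \<open>\<open>line_integral M N \<gamma>\<close> is the integral of \<open>M dt\<^sub>1 + N dt\<^sub>2\<close> along a piecewise
  differentiable path \<open>\<gamma>\<close> on \<open>[0, 1]\<close>; the finitely many corners do not contribute.\<close>

definition line_integral :: "(real \<times> real \<Rightarrow> real) \<Rightarrow> (real \<times> real \<Rightarrow> real) \<Rightarrow>
    (real \<Rightarrow> real \<times> real) \<Rightarrow> real" where
  "line_integral M N \<gamma> = integral {0..1} (\<lambda>s.
      M (\<gamma> s) * fst (vector_derivative \<gamma> (at s within {0..1}))
    + N (\<gamma> s) * snd (vector_derivative \<gamma> (at s within {0..1})))"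

definition rect_boundary :: "real \<Rightarrow> real \<Rightarrow> real \<Rightarrow> real \<Rightarrow> real \<Rightarrow> real \<times> real" where
  "rect_boundary a1 b1 a2 b2 =
     linepath (a1, a2) (b1, a2) +++ linepath (b1, a2) (b1, b2) +++
     linepath (b1, b2) (a1, b2) +++ linepath (a1, b2) (a1, a2)"

end

theory Submission
  imports Defs
begin

text \<open>After replacing the kernel by an almost everywhere equal Borel function, both one-sided
  integrals merge into a single convolution of \<open>\<phi>\<close>, cut off outside \<open>[a, b]\<close>, with one
  integrable function \<open>W\<close>, and passing to the dual parameter set reflects \<open>W\<close>. So
  Fubini's theorem moves the operator from \<open>\<partial>\<eta>/\<partial>t\<^sub>i\<close> onto the other factor with the
  dual parameters, and ordinary integration by parts in \<open>t\<^sub>i\<close> gives the derivative term and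
  two edges of the boundary. Dominated convergence shows that the operators preserve
  continuity in both variables, which lets the order of integration be exchanged.\<close>

subsection \<open>The one-dimensional operator as a convolution\<close>

definition cutoff :: "real \<Rightarrow> real \<Rightarrow> (real \<Rightarrow> real) \<Rightarrow> real \<Rightarrow> real" where
  "cutoff a b \<phi> = (\<lambda>x. indicator {a..b} x * \<phi> x)"

definition conv_int :: "(real \<Rightarrow> real) \<Rightarrow> (real \<Rightarrow> real) \<Rightarrow> real \<Rightarrow> real" where
  "conv_int W \<phi> t = (LINT x|lborel. W (t - x) * \<phi> x)"

text \<open>The one-variable operator behind both \<open>K1\<close> and \<open>K2\<close>, with the
  other coordinate frozen. It keeps the gauge integrals of those definitions;
  \<open>conv_int\<close> is its Lebesgue counterpart.\<close>

definition frac_int :: "(real \<Rightarrow> real) \<Rightarrow> real \<Rightarrow> real \<Rightarrow> real \<Rightarrow> real \<Rightarrow> (real \<Rightarrow> real) \<Rightarrow> real \<Rightarrow> real" where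
  "frac_int k a b p q \<phi> t =
     p * integral {a..t} (\<lambda>\<tau>. k (t - \<tau>) * \<phi> \<tau>) + q * integral {t..b} (\<lambda>\<tau>. k (\<tau> - t) * \<phi> \<tau>)"

lemma cutoff_measurable:
  assumes "continuous_on {a..b} \<phi>"
  shows "cutoff a b \<phi> \<in> borel_measurable borel"
  using borel_measurable_continuous_on_indicator[OF _ assms] by (simp add: cutoff_def)

lemma cutoff_bounded:
  assumes "continuous_on {a..b} \<phi>"
  obtains M where "0 \<le> M" "\<And>x. \<bar>cutoff a b \<phi> x\<bar> \<le> M"
proof -
  have "bounded (\<phi> ` {a..b})"
    by (intro compact_imp_bounded compact_continuous_image assms) auto
  then obtain M where "\<forall>x\<in>{a..b}. \<bar>\<phi> x\<bar> \<le> M"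
    by (auto simp: bounded_iff)
  then have "\<bar>cutoff a b \<phi> x\<bar> \<le> max 0 M" for x
    by (auto simp: cutoff_def indicator_def le_max_iff_disj)
  then show thesis using that[of "max 0 M"] by auto
qed

text \<open>Bridge from Lebesgue to gauge integrals: the latter ignore negligible sets, so an
  integrable \<open>G\<close> that agrees almost everywhere with \<open>F\<close> cut off outside
  \<open>S\<close> determines the integral of \<open>F\<close> itself.\<close>

lemma has_integral_AE_eq:
  fixes F G :: "real \<Rightarrow> real"
  assumes G: "integrable lborel G"
    and eq: "AE x in lborel. G x = (if x \<in> S then F x else 0)"
  shows "(F has_integral (LINT x|lborel. G x)) S"
proof -
  obtain N where N: "N \<in> null_sets lborel" "{x. \<not> G x = (if x \<in> S then F x else 0)} \<subseteq> N"
    using eq by (auto simp: eventually_ae_filter)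
  then have "negligible N"
    by (auto simp: negligible_iff_null_sets null_sets_completionI)
  moreover have "(G has_integral (LINT x|lborel. G x)) UNIV"
    by (rule has_integral_integral_lborel[OF G])
  moreover have "(if x \<in> S then F x else 0) = G x" if "x \<in> UNIV - N" for x
    using N(2) that by (metis (mono_tags, lifting) DiffD2 mem_Collect_eq subsetD)
  ultimately have "((\<lambda>x. if x \<in> S then F x else 0) has_integral (LINT x|lborel. G x)) UNIV"
    using has_integral_spike[of N UNIV "\<lambda>x. if x \<in> S then F x else 0" G] by blast
  then show ?thesis
    by (simp add: has_integral_restrict_UNIV)
qed

text \<open>The product is dominated by \<open>M\<close> times the rescaled \<open>W\<close>. The
  values \<open>c = -1\<close> and \<open>c = 1\<close> yield the arguments t - x and x - t of the
  two one-sided integrals.\<close>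

lemma integrable_affine_mult_bounded:
  fixes W \<phi> :: "real \<Rightarrow> real"
  assumes "integrable lborel W" "\<phi> \<in> borel_measurable borel" "\<And>x. \<bar>\<phi> x\<bar> \<le> M" "c \<noteq> 0"
  shows "integrable lborel (\<lambda>x. W (t + c * x) * \<phi> x)"
proof (rule Bochner_Integration.integrable_bound)
  have [measurable]: "W \<in> borel_measurable borel" "\<phi> \<in> borel_measurable borel"
    using assms by auto
  show "integrable lborel (\<lambda>x. M * W (t + c * x))"
    using assms by (intro integrable_mult_right lborel_integrable_real_affine)
  show "(\<lambda>x. W (t + c * x) * \<phi> x) \<in> borel_measurable lborel"
    by measurable
  have "0 \<le> M" using assms(3)[of 0] by linarith
  then show "AE x in lborel. norm (W (t + c * x) * \<phi> x) \<le> norm (M * W (t + c * x))"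
    using assms(3) by (auto simp: abs_mult mult.commute[of _ "\<bar>\<phi> _\<bar>"] intro!: mult_right_mono)
qed

text \<open>An affine bijection pulls null sets back to null sets. The exceptional set of
  \<open>P\<close> may fail to be Borel, so the argument runs with a Borel null set \<open>N\<close>
  containing it.\<close>

lemma AE_lborel_affine:
  fixes c :: real
  assumes "AE x in lborel. P x" "c \<noteq> 0"
  shows "AE x in lborel. P (t + c * x)"
proof -
  obtain N where N: "N \<in> null_sets lborel" "{x. \<not> P x} \<subseteq> N"
    using assms(1) by (auto simp: eventually_ae_filter)
  then have [measurable]: "N \<in> sets borel" by auto
  have "AE x in lborel. t + c * x \<notin> N"
    by (rule AE_borel_affine) (use AE_not_in[OF N(1)] assms(2) in auto)
  then show ?thesis
    by eventually_elim (use N(2) in auto)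
qed

text \<open>Substituting s = t - x moves \<open>t\<close> out of \<open>W\<close>, which is merely
  integrable, so that one dominating function in \<open>s\<close> can serve for all
  \<open>t\<close>.\<close>

lemma conv_int_shift:
  "conv_int W \<phi> t = (LINT s|lborel. W s * \<phi> (t - s))"
  using lborel_integral_real_affine[of "-1" "\<lambda>x. W (t - x) * \<phi> x" t]
  by (simp add: conv_int_def)

lemma conv_int_fubini:
  fixes W \<phi> \<psi> :: "real \<Rightarrow> real"
  assumes W: "integrable lborel W"
    and \<phi>: "continuous_on {a..b} \<phi>" and \<psi>: "continuous_on {a..b} \<psi>"
  shows "(LINT t|lborel. cutoff a b \<psi> t * conv_int W (cutoff a b \<phi>) t)
       = (LINT t|lborel. cutoff a b \<phi> t * conv_int (\<lambda>s. W (- s)) (cutoff a b \<psi>) t)"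
proof -
  define u where "u = cutoff a b \<psi>"
  define v where "v = cutoff a b \<phi>"
  have [measurable]: "W \<in> borel_measurable borel" using W by auto
  have [measurable]: "u \<in> borel_measurable borel" "v \<in> borel_measurable borel"
    using cutoff_measurable \<phi> \<psi> by (auto simp: u_def v_def)
  obtain M where M: "0 \<le> M" "\<And>x. \<bar>u x\<bar> \<le> M"
    using cutoff_bounded[OF \<psi>] unfolding u_def by metis
  obtain L where L: "0 \<le> L" "\<And>x. \<bar>v x\<bar> \<le> L"
    using cutoff_bounded[OF \<phi>] unfolding v_def by metis
  have int: "integrable lborel (\<lambda>\<tau>. W (t - \<tau>) * v \<tau>)" for t
    using integrable_affine_mult_bounded[OF W _ L(2), where c="-1" and t=t] by simp
  have int': "integrable lborel (\<lambda>\<tau>. W (t - \<tau>))" for t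
    using lborel_integrable_real_affine[OF W, of "-1" t] by simp
  have "integrable (lborel \<Otimes>\<^sub>M lborel) (\<lambda>(t, \<tau>). u t * (W (t - \<tau>) * v \<tau>))"
  proof (rule lborel_pair.Fubini_integrable)
    show "(\<lambda>(t, \<tau>). u t * (W (t - \<tau>) * v \<tau>)) \<in> borel_measurable (lborel \<Otimes>\<^sub>M lborel)"
      by measurable
    \<comment> \<open>Integrating absolute values over \<tau> first gives at most the L1 norm of
      \<open>W\<close> times the bound \<open>L\<close>, uniformly in \<open>t\<close>. As
      \<open>u\<close> is bounded with bounded support, the double integral converges
      absolutely.\<close>
    have *: "(LINT \<tau>|lborel. \<bar>W (t - \<tau>)\<bar> * \<bar>v \<tau>\<bar>) \<le> (LINT s|lborel. \<bar>W s\<bar>) * L" for t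
    proof -
      have "(LINT \<tau>|lborel. \<bar>W (t - \<tau>)\<bar> * \<bar>v \<tau>\<bar>) \<le> (LINT \<tau>|lborel. \<bar>W (t - \<tau>)\<bar> * L)"
        using integrable_abs[OF int[of t]] integrable_abs[OF int'[of t]] L(2)
        by (intro integral_mono) (auto simp: abs_mult intro!: mult_left_mono)
      also have "\<dots> = (LINT s|lborel. \<bar>W s\<bar>) * L"
        using lborel_integral_real_affine[of "-1" "\<lambda>x. \<bar>W (t - x)\<bar>" t] by simp
      finally show ?thesis .
    qed
    have "integrable lborel (\<lambda>t. \<bar>u t\<bar> * (LINT \<tau>|lborel. \<bar>W (t - \<tau>)\<bar> * \<bar>v \<tau>\<bar>))"
    proof (rule Bochner_Integration.integrable_bound)
      show "integrable lborel (\<lambda>t. indicator {a..b} t * (M * ((LINT s|lborel. \<bar>W s\<bar>) * L)))"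
        by (intro integrable_mult_left integrable_real_indicator) (auto simp: emeasure_lborel_Icc_eq)
      have "\<bar>u t\<bar> \<le> indicator {a..b} t * M" for t
        using M(2)[of t] by (auto simp: u_def cutoff_def split: split_indicator)
      moreover have pos: "0 \<le> (LINT \<tau>|lborel. \<bar>W (t - \<tau>)\<bar> * \<bar>v \<tau>\<bar>)" for t
        by (intro integral_nonneg_AE) auto
      ultimately have "\<bar>u t\<bar> * (LINT \<tau>|lborel. \<bar>W (t - \<tau>)\<bar> * \<bar>v \<tau>\<bar>)
          \<le> (indicator {a..b} t * M) * ((LINT s|lborel. \<bar>W s\<bar>) * L)" for t
        using * M(1) by (intro mult_mono) auto
      then show "AE t in lborel. norm (\<bar>u t\<bar> * (LINT \<tau>|lborel. \<bar>W (t - \<tau>)\<bar> * \<bar>v \<tau>\<bar>))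
          \<le> norm (indicator {a..b} t * (M * ((LINT s|lborel. \<bar>W s\<bar>) * L)))"
        using M(1) L(1) pos by (auto simp: abs_mult mult.assoc)
      have "(\<lambda>t. LINT \<tau>|lborel. \<bar>W (t - \<tau>)\<bar> * \<bar>v \<tau>\<bar>) \<in> borel_measurable lborel"
        by (rule lborel.borel_measurable_lebesgue_integral) measurable
      then show "(\<lambda>t. \<bar>u t\<bar> * (LINT \<tau>|lborel. \<bar>W (t - \<tau>)\<bar> * \<bar>v \<tau>\<bar>)) \<in> borel_measurable lborel"
        by simp
    qed
    then show "integrable lborel (\<lambda>t. LINT \<tau>|lborel. norm (case (t, \<tau>) of (t, \<tau>) \<Rightarrow> u t * (W (t - \<tau>) * v \<tau>)))"
      by (simp add: abs_mult)
    show "AE t in lborel. integrable lborel (\<lambda>\<tau>. case (t, \<tau>) of (t, \<tau>) \<Rightarrow> u t * (W (t - \<tau>) * v \<tau>))"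
      using int by auto
  qed
  then have "(LINT t|lborel. LINT \<tau>|lborel. u t * (W (t - \<tau>) * v \<tau>)) =
      (LINT \<tau>|lborel. LINT t|lborel. u t * (W (t - \<tau>) * v \<tau>))"
    by (rule lborel_pair.Fubini_integral[symmetric])
  \<comment> \<open>Read as a function of \<tau>, the weight \<open>W (t - \<tau>)\<close> is the
    reflected kernel at \<tau> - t, so the inner integral is the second convolution.\<close>
  also have "\<dots> = (LINT \<tau>|lborel. v \<tau> * (LINT t|lborel. W (t - \<tau>) * u t))"
  proof (rule Bochner_Integration.integral_cong[OF refl])
    fix \<tau>
    have "u t * (W (t - \<tau>) * v \<tau>) = v \<tau> * (W (t - \<tau>) * u t)" for t
      by simp
    then show "(LINT t|lborel. u t * (W (t - \<tau>) * v \<tau>)) = v \<tau> * (LINT t|lborel. W (t - \<tau>) * u t)"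
      by (simp only: integral_mult_right_zero)
  qed
  finally show ?thesis
    by (simp add: conv_int_def u_def v_def)
qed

text \<open>The kernel is only Lebesgue measurable, so \<open>k (t - \<tau>)\<close> need not be measurable for the
  product of two Borel measures, to which Fubini's theorem is applied.\<close>

lemma absolutely_integrable_borel_representative:
  fixes k :: "real \<Rightarrow> real"
  assumes "k absolutely_integrable_on {c..d}"
  obtains \<kappa> where "integrable lborel \<kappa>"
    "AE s in lborel. \<kappa> s = (if s \<in> {c..d} then k s else 0)"
proof -
  define K where "K = (\<lambda>s. if s \<in> {c..d} then k s else 0)"
  have K: "integrable lebesgue K"
  proof -
    have "K = (\<lambda>s. indicator {c..d} s *\<^sub>R k s)"
      by (auto simp: K_def fun_eq_iff)
    then show ?thesis
      using assms by (simp add: set_integrable_def)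
  qed
  then obtain \<kappa> where \<kappa>: "\<kappa> \<in> borel_measurable lborel" "AE s in lborel. K s = \<kappa> s"
    using completion_ex_borel_measurable_real[of K lborel] by auto
  have "integrable lebesgue \<kappa>"
    by (rule Bochner_Integration.integrable_cong_AE_imp[OF K])
      (use \<kappa> in \<open>auto intro: AE_completion measurable_completion\<close>)
  then have "integrable lborel \<kappa>"
    using \<kappa>(1) by (simp add: integrable_completion)
  moreover have "AE s in lborel. \<kappa> s = K s"
    using \<kappa>(2) by eventually_elim simp
  ultimately show thesis
    using that unfolding K_def by blast
qed

lemma frac_int_eq_conv_int:
  fixes k :: "real \<Rightarrow> real"
  assumes ab: "a < b" and k: "k absolutely_integrable_on {0..b - a}"
  obtains W where "integrable lborel W"
    "\<And>\<phi> t. \<lbrakk>continuous_on {a..b} \<phi>; t \<in> {a..b}\<rbrakk> \<Longrightarrow>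
      frac_int k a b p q \<phi> t = conv_int W (cutoff a b \<phi>) t"
    "\<And>\<phi> t. \<lbrakk>continuous_on {a..b} \<phi>; t \<in> {a..b}\<rbrakk> \<Longrightarrow>
      frac_int k a b q p \<phi> t = conv_int (\<lambda>s. W (- s)) (cutoff a b \<phi>) t"
proof -
  obtain \<kappa> where \<kappa>: "integrable lborel \<kappa>"
    and eq: "AE s in lborel. \<kappa> s = (if s \<in> {0..b - a} then k s else 0)"
    using absolutely_integrable_borel_representative[OF k] .
  \<comment> \<open>Almost everywhere on the relevant range, \<open>W p q s\<close> is p k(s) for s
    > 0 and q k(-s) for s < 0: the sign of t - x decides to which one-sided integral the point
    \<open>x\<close> belongs.\<close>
  define W where "W p q s = p * \<kappa> s + q * \<kappa> (- s)" for p q s :: real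
  have \<kappa>': "integrable lborel (\<lambda>s. \<kappa> (- s))"
    using lborel_integrable_real_affine[OF \<kappa>, of "-1" 0] by simp
  have "frac_int k a b p q \<phi> t = conv_int (W p q) (cutoff a b \<phi>) t"
    if \<phi>: "continuous_on {a..b} \<phi>" and t: "t \<in> {a..b}" for p q \<phi> t
  proof -
    obtain M where M: "\<And>x. \<bar>cutoff a b \<phi> x\<bar> \<le> M"
      using cutoff_bounded[OF \<phi>] by metis
    note int = integrable_affine_mult_bounded[OF \<kappa> cutoff_measurable[OF \<phi>] M]
    have 1: "integrable lborel (\<lambda>x. \<kappa> (t - x) * cutoff a b \<phi> x)"
      using int[where c="-1" and t=t] by simp
    have 2: "integrable lborel (\<lambda>x. \<kappa> (x - t) * cutoff a b \<phi> x)"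
      using int[where c=1 and t="- t"] by simp
    have "AE x in lborel. \<kappa> (t + (-1) * x) = (if t + (-1) * x \<in> {0..b - a} then k (t + (-1) * x) else 0)"
      by (rule AE_lborel_affine[OF eq]) simp
    \<comment> \<open>For \<open>t\<close> and \<open>x\<close> in \<open>{a..b}\<close> the bound t
      - x \<le> b - a is automatic, so the cutoffs of \<kappa> and \<phi> together leave exactly the
      range \<open>{a..t}\<close>.\<close>
    then have "AE x in lborel. \<kappa> (t - x) * cutoff a b \<phi> x = (if x \<in> {a..t} then k (t - x) * \<phi> x else 0)"
      by eventually_elim (use t in \<open>auto simp: cutoff_def split: split_indicator\<close>)
    note L = has_integral_AE_eq[OF 1 this]
    have "AE x in lborel. \<kappa> (- t + 1 * x) = (if - t + 1 * x \<in> {0..b - a} then k (- t + 1 * x) else 0)"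
      by (rule AE_lborel_affine[OF eq]) simp
    then have "AE x in lborel. \<kappa> (x - t) * cutoff a b \<phi> x = (if x \<in> {t..b} then k (x - t) * \<phi> x else 0)"
      by eventually_elim (use t in \<open>auto simp: cutoff_def split: split_indicator\<close>)
    note R = has_integral_AE_eq[OF 2 this]
    show ?thesis
      using 1 2 L[THEN integral_unique] R[THEN integral_unique]
      by (simp add: frac_int_def conv_int_def W_def ring_distribs mult.assoc)
  qed
  \<comment> \<open>Reflection exchanges the weights; the preceding claim holds for all
    \<open>p\<close> and \<open>q\<close>, so it covers the dual case too.\<close>
  moreover have "(\<lambda>s. W p q (- s)) = W q p"
    by (simp add: W_def fun_eq_iff)
  moreover have "integrable lborel (W p q)"
    unfolding W_def using \<kappa> \<kappa>' by simp
  ultimately show thesis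
    using that[of "W p q"] by simp
qed

section \<open>Continuity of the operator jointly in its variable and a parameter\<close>

lemma continuous_on_conv_int:
  fixes h :: "real \<times> real \<Rightarrow> real"
  assumes W: "integrable lborel W" and "compact Y" and h: "continuous_on ({a..b} \<times> Y) h"
  shows "continuous_on (UNIV \<times> Y) (\<lambda>(x, y). conv_int W (cutoff a b (\<lambda>\<tau>. h (\<tau>, y))) x)"
  unfolding continuous_on_sequentially
proof (intro ballI allI impI, elim conjE)
  fix z :: "real \<times> real" and zs :: "nat \<Rightarrow> real \<times> real"
  assume "z \<in> UNIV \<times> Y" and zs: "\<forall>n. zs n \<in> UNIV \<times> Y" "zs \<longlonglongrightarrow> z"
  then obtain x y where z: "z = (x, y)" "y \<in> Y" by auto
  have lim: "(\<lambda>n. fst (zs n)) \<longlonglongrightarrow> x" "(\<lambda>n. snd (zs n)) \<longlonglongrightarrow> y"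
    using tendsto_fst[OF zs(2)] tendsto_snd[OF zs(2)] by (simp_all add: z)
  have Y: "snd (zs n) \<in> Y" for n
    using zs(1) by (metis mem_Times_iff)
  have "bounded (h ` ({a..b} \<times> Y))"
    by (intro compact_imp_bounded compact_continuous_image h compact_Times) (use assms in auto)
  then obtain M where M: "\<And>u. u \<in> {a..b} \<times> Y \<Longrightarrow> \<bar>h u\<bar> \<le> M"
    by (auto simp: bounded_iff)
  define H where "H y' = cutoff a b (\<lambda>\<tau>. h (\<tau>, y'))" for y'
  have [measurable]: "W \<in> borel_measurable borel" using W by auto
  have H: "H y' \<in> borel_measurable borel" if "y' \<in> Y" for y'
    unfolding H_def using that
    by (intro cutoff_measurable continuous_on_compose2[OF h] continuous_intros) auto
  have [measurable]: "H y \<in> borel_measurable borel" "\<And>n. H (snd (zs n)) \<in> borel_measurable borel"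
    using H z Y by auto
  \<comment> \<open>In the shifted form, |W| times a bound of \<open>h\<close> dominates along the
    whole sequence; compactness of \<open>Y\<close> supplies this bound.\<close>
  have "(\<lambda>n. LINT s|lborel. W s * H (snd (zs n)) (fst (zs n) - s)) \<longlonglongrightarrow> (LINT s|lborel. W s * H y (x - s))"
  proof (rule integral_dominated_convergence)
    show "(\<lambda>s. W s * H y (x - s)) \<in> borel_measurable lborel"
      by measurable
    show "(\<lambda>s. W s * H (snd (zs n)) (fst (zs n) - s)) \<in> borel_measurable lborel" for n
      by measurable
    show "integrable lborel (\<lambda>s. \<bar>W s\<bar> * max 0 M)"
      using W by auto
    have "\<bar>H y' u\<bar> \<le> max 0 M" if "y' \<in> Y" for y' u
      using M that by (auto simp: H_def cutoff_def le_max_iff_disj split: split_indicator)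
    then show "AE s in lborel. norm (W s * H (snd (zs n)) (fst (zs n) - s)) \<le> \<bar>W s\<bar> * max 0 M" for n
      using Y by (auto simp: abs_mult intro!: mult_left_mono)
    \<comment> \<open>The cutoff can jump only at \<open>a\<close> and \<open>b\<close>, so
      pointwise convergence can fail for at most two values of \<open>s\<close>.\<close>
    have "AE s in lborel. s \<noteq> x - a" "AE s in lborel. s \<noteq> x - b"
      by (rule AE_lborel_singleton)+
    then show "AE s in lborel. (\<lambda>n. W s * H (snd (zs n)) (fst (zs n) - s)) \<longlonglongrightarrow> W s * H y (x - s)"
    proof eventually_elim
      fix s assume s: "s \<noteq> x - a" "s \<noteq> x - b"
      have ls: "(\<lambda>n. fst (zs n) - s) \<longlonglongrightarrow> x - s"
        by (intro tendsto_intros lim)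
      consider "x - s < a" | "x - s > b" | "a < x - s" "x - s < b"
        using s by linarith
      then have "(\<lambda>n. H (snd (zs n)) (fst (zs n) - s)) \<longlonglongrightarrow> H y (x - s)"
      proof cases
        case 1
        have "\<forall>\<^sub>F n in sequentially. fst (zs n) - s < a"
          using order_tendstoD(2)[OF ls 1] .
        then have "\<forall>\<^sub>F n in sequentially. H (snd (zs n)) (fst (zs n) - s) = 0"
          by eventually_elim (auto simp: H_def cutoff_def)
        moreover have "H y (x - s) = 0" using 1 by (auto simp: H_def cutoff_def)
        ultimately show ?thesis by (simp add: tendsto_eventually)
      next
        case 2
        have "\<forall>\<^sub>F n in sequentially. fst (zs n) - s > b"
          using order_tendstoD(1)[OF ls 2] .
        then have "\<forall>\<^sub>F n in sequentially. H (snd (zs n)) (fst (zs n) - s) = 0"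
          by eventually_elim (auto simp: H_def cutoff_def)
        moreover have "H y (x - s) = 0" using 2 by (auto simp: H_def cutoff_def)
        ultimately show ?thesis by (simp add: tendsto_eventually)
      next
        case 3
        have ev: "\<forall>\<^sub>F n in sequentially. fst (zs n) - s \<in> {a..b}"
          using order_tendstoD(1)[OF ls 3(1)] order_tendstoD(2)[OF ls 3(2)]
          by eventually_elim auto
        have "(\<lambda>n. h (fst (zs n) - s, snd (zs n))) \<longlonglongrightarrow> h (x - s, y)"
          by (rule continuous_on_tendsto_compose[OF h])
            (use ev Y z 3 in \<open>auto intro!: tendsto_intros lim elim: eventually_mono\<close>)
        moreover have "\<forall>\<^sub>F n in sequentially. h (fst (zs n) - s, snd (zs n)) = H (snd (zs n)) (fst (zs n) - s)"
          using ev by eventually_elim (auto simp: H_def cutoff_def)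
        moreover have "H y (x - s) = h (x - s, y)"
          using 3 by (auto simp: H_def cutoff_def)
        ultimately show ?thesis
          by (simp add: tendsto_cong)
      qed
      then show "(\<lambda>n. W s * H (snd (zs n)) (fst (zs n) - s)) \<longlonglongrightarrow> W s * H y (x - s)"
        by (intro tendsto_intros)
    qed
  qed
  then show "((\<lambda>(x, y). conv_int W (cutoff a b (\<lambda>\<tau>. h (\<tau>, y))) x) \<circ> zs)
      \<longlonglongrightarrow> (case z of (x, y) \<Rightarrow> conv_int W (cutoff a b (\<lambda>\<tau>. h (\<tau>, y))) x)"
    by (simp add: z conv_int_shift H_def o_def case_prod_beta)
qed

lemma continuous_on_frac_int:
  fixes h :: "real \<times> real \<Rightarrow> real"
  assumes ab: "a < b" and k: "k absolutely_integrable_on {0..b - a}"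
    and Y: "compact Y" and h: "continuous_on ({a..b} \<times> Y) h"
  shows "continuous_on ({a..b} \<times> Y) (\<lambda>(x, y). frac_int k a b p q (\<lambda>\<tau>. h (\<tau>, y)) x)"
proof -
  obtain W where W: "integrable lborel W"
    and eq: "\<And>\<phi> t. \<lbrakk>continuous_on {a..b} \<phi>; t \<in> {a..b}\<rbrakk> \<Longrightarrow>
      frac_int k a b p q \<phi> t = conv_int W (cutoff a b \<phi>) t"
    using frac_int_eq_conv_int[OF ab k] by metis
  have "continuous_on ({a..b} \<times> Y) (\<lambda>(x, y). conv_int W (cutoff a b (\<lambda>\<tau>. h (\<tau>, y))) x)"
    by (rule continuous_on_subset[OF continuous_on_conv_int[OF W Y h]]) auto
  moreover have "continuous_on {a..b} (\<lambda>\<tau>. h (\<tau>, y))" if "y \<in> Y" for y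
    using that by (intro continuous_on_compose2[OF h] continuous_intros) auto
  ultimately show ?thesis
    by (subst continuous_on_cong[OF refl]) (auto simp: eq)
qed

text \<open>The preceding lemma with a parameter set reduced to the single point 0.\<close>

lemma continuous_on_frac_int_1:
  assumes "a < b" "k absolutely_integrable_on {0..b - a}" "continuous_on {a..b} \<phi>"
  shows "continuous_on {a..b} (frac_int k a b p q \<phi>)"
proof -
  have "continuous_on ({a..b} \<times> {0}) (\<lambda>z :: real \<times> real. \<phi> (fst z))"
    using assms(3) by (intro continuous_on_compose2[OF assms(3)] continuous_intros) auto
  from continuous_on_frac_int[OF assms(1,2) _ this]
  have "continuous_on ({a..b} \<times> {0::real}) (\<lambda>(x, y). frac_int k a b p q \<phi> x)"
    by simp
  then have "continuous_on {a..b} (\<lambda>x. (\<lambda>(x, y). frac_int k a b p q \<phi> x) (x, 0::real))"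
    by (rule continuous_on_compose2) (auto intro!: continuous_intros)
  then show ?thesis by simp
qed

text \<open>In the application \<open>F\<close> is \<open>frac_int\<close> and \<open>G\<close> the
  convolution, known to agree on \<open>{a..b}\<close>; the cutoff of \<psi> discards everything
  outside.\<close>

lemma lborel_integral_cutoff:
  assumes "continuous_on {a..b} \<psi>" "continuous_on {a..b} F" "\<And>t. t \<in> {a..b} \<Longrightarrow> F t = G t"
  shows "(LINT t|lborel. cutoff a b \<psi> t * G t) = integral {a..b} (\<lambda>t. \<psi> t * F t)"
proof -
  have "set_integrable lborel {a..b} (\<lambda>t. \<psi> t * F t)"
    using assms by (intro borel_integrable_atLeastAtMost' continuous_intros)
  from set_borel_integral_eq_integral(2)[OF this]
  have "integral {a..b} (\<lambda>t. \<psi> t * F t) = (LINT t|lborel. indicator {a..b} t *\<^sub>R (\<psi> t * F t))"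
    by (simp add: set_lebesgue_integral_def)
  also have "\<dots> = (LINT t|lborel. cutoff a b \<psi> t * G t)"
    by (rule Bochner_Integration.integral_cong)
      (auto simp: cutoff_def assms(3) split: split_indicator)
  finally show ?thesis by simp
qed

subsection \<open>Integration by parts\<close>

text \<open>Both sides are iterated integrals of \<psi>(t) W(t - \<tau>) \<phi>(\<tau>), in opposite
  orders. Continuity of the operator's values lets the outer Lebesgue integrals be read as gauge
  integrals.\<close>

lemma frac_int_duality:
  assumes ab: "a < b" and k: "k absolutely_integrable_on {0..b - a}"
    and \<phi>: "continuous_on {a..b} \<phi>" and \<psi>: "continuous_on {a..b} \<psi>"
  shows "integral {a..b} (\<lambda>t. \<psi> t * frac_int k a b p q \<phi> t)
       = integral {a..b} (\<lambda>t. \<phi> t * frac_int k a b q p \<psi> t)"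
proof -
  obtain W where W: "integrable lborel W"
    and eq: "\<And>\<phi> t. \<lbrakk>continuous_on {a..b} \<phi>; t \<in> {a..b}\<rbrakk> \<Longrightarrow>
      frac_int k a b p q \<phi> t = conv_int W (cutoff a b \<phi>) t"
      "\<And>\<phi> t. \<lbrakk>continuous_on {a..b} \<phi>; t \<in> {a..b}\<rbrakk> \<Longrightarrow>
      frac_int k a b q p \<phi> t = conv_int (\<lambda>s. W (- s)) (cutoff a b \<phi>) t"
    using frac_int_eq_conv_int[OF ab k] by metis
  show ?thesis
    using conv_int_fubini[OF W \<phi> \<psi>]
      lborel_integral_cutoff[OF \<psi> continuous_on_frac_int_1[OF ab k \<phi>] eq(1)[OF \<phi>]]
      lborel_integral_cutoff[OF \<phi> continuous_on_frac_int_1[OF ab k \<psi>] eq(2)[OF \<psi>]]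
    by simp
qed

lemma frac_int_by_parts:
  assumes ab: "a < b" and k: "k absolutely_integrable_on {0..b - a}"
    and g: "continuous_on {a..b} g"
    and \<eta>: "\<And>x. x \<in> {a..b} \<Longrightarrow> (\<eta> has_vector_derivative \<eta>' x) (at x within {a..b})"
    and \<eta>': "continuous_on {a..b} \<eta>'"
    and D: "\<And>x. x \<in> {a..b} \<Longrightarrow>
      (frac_int k a b q p g has_vector_derivative D x) (at x within {a..b})"
    and D': "continuous_on {a..b} D"
  shows "integral {a..b} (\<lambda>t. g t * frac_int k a b p q \<eta>' t)
       = \<eta> b * frac_int k a b q p g b - \<eta> a * frac_int k a b q p g a
         - integral {a..b} (\<lambda>t. \<eta> t * D t)"
proof -
  let ?K = "frac_int k a b q p g"
  have c: "continuous_on {a..b} \<eta>" "continuous_on {a..b} ?K"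
    using \<eta> D has_vector_derivative_continuous continuous_on_eq_continuous_within by blast+
  have "((\<lambda>x. \<eta> x * ?K x) has_vector_derivative \<eta> x * D x + \<eta>' x * ?K x) (at x within {a..b})"
    if "x \<in> {a..b}" for x
    using has_vector_derivative_mult[OF \<eta>[OF that] D[OF that]] .
  then have "((\<lambda>x. \<eta> x * D x + \<eta>' x * ?K x) has_integral \<eta> b * ?K b - \<eta> a * ?K a) {a..b}"
    using ab fundamental_theorem_of_calculus[of a b "\<lambda>x. \<eta> x * ?K x"] by simp
  then have "integral {a..b} (\<lambda>x. \<eta> x * D x + \<eta>' x * ?K x) = \<eta> b * ?K b - \<eta> a * ?K a"
    by (rule integral_unique)
  moreover have "integral {a..b} (\<lambda>x. \<eta> x * D x + \<eta>' x * ?K x)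
      = integral {a..b} (\<lambda>x. \<eta> x * D x) + integral {a..b} (\<lambda>x. \<eta>' x * ?K x)"
    by (intro Henstock_Kurzweil_Integration.integral_add integrable_continuous_real continuous_intros c D' \<eta>')
  \<comment> \<open>Duality with \<open>\<eta>'\<close> in the role of \<phi> rewrites the left side
    as the integral of \<open>\<eta>'\<close> times the dual operator on \<open>g\<close>, the
    remaining term of the product rule.\<close>
  ultimately show ?thesis
    using frac_int_duality[OF ab k \<eta>' g, of p q] by linarith
qed

section \<open>Functions of two variables, one coordinate at a time\<close>

lemma C1_on_continuous_on: "C1_on S h \<Longrightarrow> continuous_on S h"
  by (auto simp: C1_on_def continuous_on_eq_continuous_within dest: has_derivative_continuous)

text \<open>Composing with the line s \<mapsto> (s, y) identifies the partial derivative as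
  \<open>D (x, y) (1, 0)\<close>, which inherits continuity from \<open>D\<close>. The condition a <
  b makes one-sided derivatives unique, so \<open>vector_derivative\<close> returns this
  value.\<close>

lemma C1_on_partial1:
  assumes h: "C1_on ({a..b} \<times> Y) h" and ab: "a < b"
  shows "\<And>x y. \<lbrakk>x \<in> {a..b}; y \<in> Y\<rbrakk> \<Longrightarrow>
      ((\<lambda>s. h (s, y)) has_vector_derivative partial1 a b h (x, y)) (at x within {a..b})"
    and "continuous_on ({a..b} \<times> Y) (partial1 a b h)"
proof -
  obtain D :: "real \<times> real \<Rightarrow> (real \<times> real) \<Rightarrow>\<^sub>L real" where
    D: "\<And>z. z \<in> {a..b} \<times> Y \<Longrightarrow> (h has_derivative blinfun_apply (D z)) (at z within {a..b} \<times> Y)"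
    and D': "continuous_on ({a..b} \<times> Y) D"
    using h by (auto simp: C1_on_def)
  have *: "((\<lambda>s. h (s, y)) has_vector_derivative D (x, y) (1, 0)) (at x within {a..b})"
    if "x \<in> {a..b}" "y \<in> Y" for x y
  proof -
    have "((\<lambda>s. (s, y)) has_derivative (\<lambda>s. (s, 0))) (at x within {a..b})"
      by (auto intro!: derivative_eq_intros)
    moreover have "(h has_derivative D (x, y)) (at (x, y) within (\<lambda>s. (s, y)) ` {a..b})"
      by (rule has_derivative_subset[OF D]) (use that in auto)
    ultimately have "(h \<circ> (\<lambda>s. (s, y)) has_derivative D (x, y) \<circ> (\<lambda>s. (s, 0))) (at x within {a..b})"
      by (rule diff_chain_within)
    moreover have "D (x, y) \<circ> (\<lambda>s. (s, 0)) = (\<lambda>s. s *\<^sub>R D (x, y) (1, 0))"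
    proof
      show "(D (x, y) \<circ> (\<lambda>s. (s, 0))) s = s *\<^sub>R D (x, y) (1, 0)" for s
        using blinfun.scaleR_right[of "D (x, y)" s "(1, 0)"] by simp
    qed
    ultimately show ?thesis
      by (simp only: has_vector_derivative_def o_def)
  qed
  have eq: "partial1 a b h (x, y) = D (x, y) (1, 0)" if "x \<in> {a..b}" "y \<in> Y" for x y
    using *[OF that] vector_derivative_within_cbox[of a b x] ab that
    by (simp add: partial1_def)
  show "((\<lambda>s. h (s, y)) has_vector_derivative partial1 a b h (x, y)) (at x within {a..b})"
    if "x \<in> {a..b}" "y \<in> Y" for x y
    using * eq that by simp
  have "continuous_on ({a..b} \<times> Y) (\<lambda>z. D z (1, 0))"
    by (intro continuous_intros D')
  then show "continuous_on ({a..b} \<times> Y) (partial1 a b h)"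
    by (subst continuous_on_cong[OF refl]) (auto simp: eq)
qed

lemma K1_eq_frac_int:
  "K1 k \<beta> (Param a b p q) h = (\<lambda>(x, y). frac_int (k \<beta>) a b p q (\<lambda>\<tau>. h (\<tau>, y)) x)"
  by (simp add: K1_def frac_int_def)

text \<open>The one-dimensional formula on each slice. The two continuity conclusions later permit
  changing the order of integration, and the abstract compact set \<open>Y\<close> lets the lemma
  serve for either coordinate.\<close>

lemma B1_by_parts:
  assumes ab: "a < b" and k: "k (1 - \<alpha>) absolutely_integrable_on {0..b - a}" and Y: "compact Y"
    and P: "P = Param a b p q"
    and g: "continuous_on ({a..b} \<times> Y) g" and \<eta>: "C1_on ({a..b} \<times> Y) \<eta>"
    and K: "C1_on ({a..b} \<times> Y) (K1 k (1 - \<alpha>) (dual P) g)"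
  shows "continuous_on ({a..b} \<times> Y) (B1 k \<alpha> P \<eta>)"
    and "continuous_on ({a..b} \<times> Y) (A1 k \<alpha> (dual P) g)"
    and "\<And>y. y \<in> Y \<Longrightarrow> integral {a..b} (\<lambda>x. g (x, y) * B1 k \<alpha> P \<eta> (x, y))
       = \<eta> (b, y) * K1 k (1 - \<alpha>) (dual P) g (b, y) - \<eta> (a, y) * K1 k (1 - \<alpha>) (dual P) g (a, y)
         - integral {a..b} (\<lambda>x. \<eta> (x, y) * A1 k \<alpha> (dual P) g (x, y))"
proof -
  note \<eta>' = C1_on_partial1[OF \<eta> ab]
  note K' = C1_on_partial1[OF K ab]
  have dual: "dual P = Param a b q p" by (simp add: P dual_def)
  show "continuous_on ({a..b} \<times> Y) (B1 k \<alpha> P \<eta>)"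
    using continuous_on_frac_int[OF ab k Y \<eta>'(2)] by (simp add: B1_def P K1_eq_frac_int)
  show "continuous_on ({a..b} \<times> Y) (A1 k \<alpha> (dual P) g)"
    using K'(2) by (simp add: A1_def dual)
  fix y assume y: "y \<in> Y"
  have c: "continuous_on {a..b} (\<lambda>x. h (x, y))" if "continuous_on ({a..b} \<times> Y) h" for h :: "real \<times> real \<Rightarrow> real"
    by (intro continuous_on_compose2[OF that] continuous_intros) (use y in auto)
  show "integral {a..b} (\<lambda>x. g (x, y) * B1 k \<alpha> P \<eta> (x, y))
       = \<eta> (b, y) * K1 k (1 - \<alpha>) (dual P) g (b, y) - \<eta> (a, y) * K1 k (1 - \<alpha>) (dual P) g (a, y)
         - integral {a..b} (\<lambda>x. \<eta> (x, y) * A1 k \<alpha> (dual P) g (x, y))"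
    using frac_int_by_parts[OF ab k c[OF g] \<eta>'(1)[OF _ y] c[OF \<eta>'(2)] _ c[OF K'(2)], of q p] K'(1)[OF _ y]
    by (simp add: B1_def A1_def dual[unfolded P] K1_eq_frac_int P)
qed

section \<open>Exchanging the two coordinates\<close>

lemma C1_on_swap:
  assumes "C1_on (A \<times> B) h"
  shows "C1_on (B \<times> A) (h \<circ> prod.swap)"
proof -
  obtain D :: "real \<times> real \<Rightarrow> (real \<times> real) \<Rightarrow>\<^sub>L real" where
    D: "\<And>z. z \<in> A \<times> B \<Longrightarrow> (h has_derivative blinfun_apply (D z)) (at z within A \<times> B)"
    and D': "continuous_on (A \<times> B) D"
    using assms by (auto simp: C1_on_def)
  have sw: "bounded_linear (prod.swap :: real \<times> real \<Rightarrow> real \<times> real)"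
    unfolding prod.swap_def by (intro bounded_linear_intros)
  \<comment> \<open>The swap is linear, hence its own derivative, so the chain rule composes
    \<open>D\<close> at the swapped point with the swap.\<close>
  define E where "E z = D (prod.swap z) o\<^sub>L Blinfun prod.swap" for z
  have "(h \<circ> prod.swap has_derivative blinfun_apply (E z)) (at z within B \<times> A)" if "z \<in> B \<times> A" for z
  proof -
    have "(h has_derivative D (prod.swap z)) (at (prod.swap z) within prod.swap ` (B \<times> A))"
      using D[of "prod.swap z"] that by (auto simp: product_swap)
    note diff_chain_within[OF bounded_linear_imp_has_derivative[OF sw] this]
    moreover have "blinfun_apply (E z) = blinfun_apply (D (prod.swap z)) \<circ> prod.swap"
      by (simp add: E_def fun_eq_iff bounded_linear_Blinfun_apply[OF sw])
    ultimately show ?thesis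
      by simp
  qed
  moreover have "continuous_on (B \<times> A) E"
    unfolding E_def
    by (intro continuous_intros continuous_on_compose2[OF D'] linear_continuous_on[OF sw]) auto
  ultimately show ?thesis
    unfolding C1_on_def by blast
qed

text \<open>This and the next three identities carry each operator in t2 to its counterpart in t1,
  so that integration by parts is proved only once.\<close>

lemma swap_K2: "K2 k \<beta> P h \<circ> prod.swap = K1 k \<beta> P (h \<circ> prod.swap)"
  by (auto simp: K1_def K2_def fun_eq_iff)

lemma swap_partial2: "partial2 a b h \<circ> prod.swap = partial1 a b (h \<circ> prod.swap)"
  by (auto simp: partial1_def partial2_def fun_eq_iff)

lemma swap_A2: "A2 k \<alpha> P h \<circ> prod.swap = A1 k \<alpha> P (h \<circ> prod.swap)"
  by (simp add: A1_def A2_def swap_partial2 swap_K2)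

lemma swap_B2: "B2 k \<alpha> P h \<circ> prod.swap = B1 k \<alpha> P (h \<circ> prod.swap)"
  by (simp add: B1_def B2_def swap_partial2 swap_K2)

lemma continuous_on_comp_swap:
  assumes "continuous_on (A \<times> B) h"
  shows "continuous_on (B \<times> A) (h \<circ> prod.swap)"
  by (intro continuous_on_compose continuous_on_swap) (use assms in \<open>simp add: product_swap\<close>)

lemma continuous_on_swap_iff:
  "continuous_on (A \<times> B) h \<longleftrightarrow> continuous_on (B \<times> A) (h \<circ> prod.swap)"
  using continuous_on_comp_swap[of A B h] continuous_on_comp_swap[of B A "h \<circ> prod.swap"]
  by (auto simp: o_def)

lemma B2_by_parts:
  assumes ab: "a < b" and k: "k (1 - \<alpha>) absolutely_integrable_on {0..b - a}" and X: "compact X"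
    and P: "P = Param a b p q"
    and f: "continuous_on (X \<times> {a..b}) f" and \<eta>: "C1_on (X \<times> {a..b}) \<eta>"
    and K: "C1_on (X \<times> {a..b}) (K2 k (1 - \<alpha>) (dual P) f)"
  shows "continuous_on (X \<times> {a..b}) (B2 k \<alpha> P \<eta>)"
    and "continuous_on (X \<times> {a..b}) (A2 k \<alpha> (dual P) f)"
    and "\<And>x. x \<in> X \<Longrightarrow> integral {a..b} (\<lambda>y. f (x, y) * B2 k \<alpha> P \<eta> (x, y))
       = \<eta> (x, b) * K2 k (1 - \<alpha>) (dual P) f (x, b) - \<eta> (x, a) * K2 k (1 - \<alpha>) (dual P) f (x, a)
         - integral {a..b} (\<lambda>y. \<eta> (x, y) * A2 k \<alpha> (dual P) f (x, y))"
proof -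
  have f': "continuous_on ({a..b} \<times> X) (f \<circ> prod.swap)"
    using f continuous_on_swap_iff by blast
  have K': "C1_on ({a..b} \<times> X) (K1 k (1 - \<alpha>) (dual P) (f \<circ> prod.swap))"
    using C1_on_swap[OF K] by (simp add: swap_K2)
  note B = B1_by_parts[OF ab k X P f' C1_on_swap[OF \<eta>] K']
  show "continuous_on (X \<times> {a..b}) (B2 k \<alpha> P \<eta>)" "continuous_on (X \<times> {a..b}) (A2 k \<alpha> (dual P) f)"
    using B(1,2) by (simp_all add: continuous_on_swap_iff[of X] swap_B2 swap_A2)
  show "integral {a..b} (\<lambda>y. f (x, y) * B2 k \<alpha> P \<eta> (x, y))
       = \<eta> (x, b) * K2 k (1 - \<alpha>) (dual P) f (x, b) - \<eta> (x, a) * K2 k (1 - \<alpha>) (dual P) f (x, a)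
         - integral {a..b} (\<lambda>y. \<eta> (x, y) * A2 k \<alpha> (dual P) f (x, y))" if "x \<in> X" for x
    using B(3)[OF that] by (simp flip: swap_A2 swap_B2 swap_K2)
qed

subsection \<open>Line integrals over a rectangle\<close>

text \<open>A relational form that carries integrability along: integrals over joined paths add when
  both exist, whereas the total function \<open>line_integral\<close> would hide a failure behind a
  default value.\<close>

definition has_line_integral :: "(real \<times> real \<Rightarrow> real) \<Rightarrow> (real \<times> real \<Rightarrow> real) \<Rightarrow>
    (real \<Rightarrow> real \<times> real) \<Rightarrow> real \<Rightarrow> bool" where
  "has_line_integral M N \<gamma> I \<longleftrightarrow>
    ((\<lambda>s. M (\<gamma> s) * fst (vector_derivative \<gamma> (at s within {0..1}))
        + N (\<gamma> s) * snd (vector_derivative \<gamma> (at s within {0..1}))) has_integral I) {0..1}"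

lemma line_integral_eqI: "has_line_integral M N \<gamma> I \<Longrightarrow> line_integral M N \<gamma> = I"
  by (simp add: has_line_integral_def line_integral_def integral_unique)

text \<open>Each half of a joined path is an affine reparametrisation of one part. At interior
  points the derivative within \<open>{0..1}\<close> is the ordinary one, so the chain rule
  contributes the factor \<open>m\<close>.\<close>

lemma vector_derivative_compose_affine:
  fixes \<gamma> g :: "real \<Rightarrow> 'a::real_normed_vector"
  assumes d: "\<gamma> differentiable at (m * s + c)"
    and U: "open U" "s \<in> U" "\<And>u. u \<in> U \<Longrightarrow> g u = \<gamma> (m * u + c)"
    and s: "0 < s" "s < 1" "0 < m * s + c" "m * s + c < 1"
  shows "vector_derivative g (at s within {0..1})
       = m *\<^sub>R vector_derivative \<gamma> (at (m * s + c) within {0..1})"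
proof -
  have "((\<lambda>u. m * u + c) has_vector_derivative m) (at s)"
    by (auto intro!: derivative_eq_intros)
  moreover have "(\<gamma> has_vector_derivative vector_derivative \<gamma> (at (m * s + c))) (at (m * s + c))"
    using d by (simp add: vector_derivative_works)
  ultimately have "((\<gamma> \<circ> (\<lambda>u. m * u + c)) has_vector_derivative
      m *\<^sub>R vector_derivative \<gamma> (at (m * s + c))) (at s)"
    by (rule vector_diff_chain_at)
  then have "(g has_vector_derivative m *\<^sub>R vector_derivative \<gamma> (at (m * s + c))) (at s)"
    by (rule has_vector_derivative_transform_within_open[OF _ U(1,2)]) (simp add: U(3))
  then show ?thesis
    using s by (simp add: at_within_Icc_at vector_derivative_at)
qed

text \<open>On each half the speed doubles while the parameter interval halves, and the two factors
  cancel. The integrands are compared off a finite set, which does not affect the integral.\<close>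

lemma has_line_integral_join:
  assumes 1: "has_line_integral M N \<gamma>1 I1" "valid_path \<gamma>1"
    and 2: "has_line_integral M N \<gamma>2 I2" "valid_path \<gamma>2"
  shows "has_line_integral M N (\<gamma>1 +++ \<gamma>2) (I1 + I2)"
proof -
  define F where "F \<gamma> s = M (\<gamma> s) * fst (vector_derivative \<gamma> (at s within {0..1}))
        + N (\<gamma> s) * snd (vector_derivative \<gamma> (at s within {0..1}))" for \<gamma> s
  obtain S1 S2
    where S1: "finite S1" "\<forall>x\<in>{0..1} - S1. \<gamma>1 differentiable at x"
      and S2: "finite S2" "\<forall>x\<in>{0..1} - S2. \<gamma>2 differentiable at x"
    using 1(2) 2(2)
    by (auto simp: valid_path_def piecewise_C1_differentiable_on_def C1_differentiable_on_eq)
  have f1: "((\<lambda>s. 2 * F \<gamma>1 (2 * s)) has_integral I1) {0..1/2}"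
    using has_integral_affinity'[of "F \<gamma>1" I1 0 1 2 0, THEN has_integral_mult_right[of _ _ _ 2]] 1(1)
    by (simp add: has_line_integral_def F_def[abs_def])
  \<comment> \<open>Excluded are the ends of the half interval and the images under x \<mapsto> x /
    2 of the points where \<open>\<gamma>1\<close> may fail to be differentiable.\<close>
  have eq1: "F (\<gamma>1 +++ \<gamma>2) s = 2 * F \<gamma>1 (2 * s)"
    if s: "s \<in> {0..1/2} - ({0, 1/2} \<union> (\<lambda>x. x / 2) ` S1)" for s
  proof -
    have "2 * s \<notin> S1"
      using s imageI[of "2 * s" S1 "\<lambda>x. x / 2"] by auto
    then have "vector_derivative (\<gamma>1 +++ \<gamma>2) (at s within {0..1})
        = 2 *\<^sub>R vector_derivative \<gamma>1 (at (2 * s + 0) within {0..1})"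
      using S1(2) s
      by (intro vector_derivative_compose_affine[where U = "{0<..<1/2}"]) (auto simp: joinpaths_def)
    moreover have "(\<gamma>1 +++ \<gamma>2) s = \<gamma>1 (2 * s)"
      using s by (simp add: joinpaths_def)
    ultimately show ?thesis
      by (simp add: F_def algebra_simps)
  qed
  have i1: "(F (\<gamma>1 +++ \<gamma>2) has_integral I1) {0..1/2}"
    by (rule has_integral_spike_finite[where S = "{0, 1/2} \<union> (\<lambda>x. x / 2) ` S1", OF _ eq1 f1]) (use S1(1) in auto)
  have f2: "((\<lambda>s. 2 * F \<gamma>2 (2 * s + (-1))) has_integral I2) {1/2..1}"
    using has_integral_affinity'[of "F \<gamma>2" I2 0 1 2 "-1", THEN has_integral_mult_right[of _ _ _ 2]] 2(1)
    by (simp add: has_line_integral_def F_def[abs_def])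
  have eq2: "F (\<gamma>1 +++ \<gamma>2) s = 2 * F \<gamma>2 (2 * s + (-1))"
    if s: "s \<in> {1/2..1} - ({1/2, 1} \<union> (\<lambda>x. (x + 1) / 2) ` S2)" for s
  proof -
    have "2 * s + (-1) \<notin> S2"
      using s imageI[of "2 * s + (-1)" S2 "\<lambda>x. (x + 1) / 2"] by auto
    then have "vector_derivative (\<gamma>1 +++ \<gamma>2) (at s within {0..1})
        = 2 *\<^sub>R vector_derivative \<gamma>2 (at (2 * s + (-1)) within {0..1})"
      using S2(2) s
      by (intro vector_derivative_compose_affine[where U = "{1/2<..<1}"]) (auto simp: joinpaths_def)
    moreover have "(\<gamma>1 +++ \<gamma>2) s = \<gamma>2 (2 * s + (-1))"
      using s by (simp add: joinpaths_def)
    ultimately show ?thesis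
      by (simp add: F_def algebra_simps)
  qed
  have i2: "(F (\<gamma>1 +++ \<gamma>2) has_integral I2) {1/2..1}"
    by (rule has_integral_spike_finite[where S = "{1/2, 1} \<union> (\<lambda>x. (x + 1) / 2) ` S2", OF _ eq2 f2]) (use S2(1) in auto)
  show ?thesis
    using has_integral_combine[OF _ _ i1 i2] by (simp add: has_line_integral_def F_def[abs_def])
qed

lemma has_integral_linepath_real:
  fixes u :: "real \<Rightarrow> real"
  assumes u: "(u has_integral I) {c..d}" and cd: "c < d"
  shows "((\<lambda>s. u (linepath c d s) * (d - c)) has_integral I) {0..1}"
    and "((\<lambda>s. u (linepath d c s) * (c - d)) has_integral - I) {0..1}"
proof -
  have eq: "inverse (d - c) * I * (d - c) = I"
    using cd by (simp add: field_simps)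
  from has_integral_affinity'[of u I c d "d - c" c, THEN has_integral_mult_left[of _ _ _ "d - c"]]
  have "((\<lambda>s. u ((d - c) * s + c) * (d - c)) has_integral I) {0..1}"
    using u cd by (simp add: eq)
  then show 1: "((\<lambda>s. u (linepath c d s) * (d - c)) has_integral I) {0..1}"
    by (simp add: linepath_def algebra_simps)
  \<comment> \<open>The reversed segment at \<open>s\<close> is the original one at 1 - s. This
    substitution keeps the integral; the sign comes from the factor c - d.\<close>
  have "((\<lambda>s. u (linepath c d (- s + 1)) * (d - c)) has_integral I) {0..1}"
    using has_integral_affinity[of "\<lambda>s. u (linepath c d s) * (d - c)" I 0 1 "-1" 1] 1
    by (simp add: image_affinity_atLeastAtMost_diff)
  from has_integral_neg[OF this]
  show "((\<lambda>s. u (linepath d c s) * (c - d)) has_integral - I) {0..1}"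
    by (simp add: linepath_def algebra_simps)
qed

lemma linepath_Pair: "linepath (x, y) (x', y') s = (linepath x x' s, linepath y y' s)"
  by (simp add: linepath_def)

lemma has_line_integral_linepath_iff:
  "has_line_integral M N (linepath A B) I \<longleftrightarrow>
    ((\<lambda>s. M (linepath A B s) * (fst B - fst A) + N (linepath A B s) * (snd B - snd A)) has_integral I) {0..1}"
  unfolding has_line_integral_def
  by (rule has_integral_cong) (simp add: vector_derivative_linepath_within)

text \<open>Along a horizontal segment dt2 = 0, so the \<open>N\<close> term vanishes; in the
  vertical case below dt1 = 0 removes the \<open>M\<close> term.\<close>

lemma has_line_integral_horizontal:
  assumes "((\<lambda>x. M (x, y)) has_integral I) {c..d}" "c < d"
  shows "has_line_integral M N (linepath (c, y) (d, y)) I"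
    and "has_line_integral M N (linepath (d, y) (c, y)) (- I)"
  using has_integral_linepath_real[OF assms]
  by (simp_all add: has_line_integral_linepath_iff linepath_Pair linepath_refl)

lemma has_line_integral_vertical:
  assumes "((\<lambda>y. N (x, y)) has_integral I) {c..d}" "c < d"
  shows "has_line_integral M N (linepath (x, c) (x, d)) I"
    and "has_line_integral M N (linepath (x, d) (x, c)) (- I)"
  using has_integral_linepath_real[OF assms]
  by (simp_all add: has_line_integral_linepath_iff linepath_Pair linepath_refl)

lemma line_integral_rect_boundary:
  assumes ab: "a1 < b1" "a2 < b2"
    and M: "continuous_on ({a1..b1} \<times> {a2..b2}) M" and N: "continuous_on ({a1..b1} \<times> {a2..b2}) N"
  shows "line_integral M N (rect_boundary a1 b1 a2 b2)
       = integral {a1..b1} (\<lambda>x. M (x, a2)) - integral {a1..b1} (\<lambda>x. M (x, b2))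
         + integral {a2..b2} (\<lambda>y. N (b1, y)) - integral {a2..b2} (\<lambda>y. N (a1, y))"
proof -
  have M': "((\<lambda>x. M (x, y)) has_integral integral {a1..b1} (\<lambda>x. M (x, y))) {a1..b1}"
    if "y \<in> {a2..b2}" for y
    by (intro integrable_integral integrable_continuous_real continuous_on_compose2[OF M] continuous_intros)
      (use that in auto)
  have N': "((\<lambda>y. N (x, y)) has_integral integral {a2..b2} (\<lambda>y. N (x, y))) {a2..b2}"
    if "x \<in> {a1..b1}" for x
    by (intro integrable_integral integrable_continuous_real continuous_on_compose2[OF N] continuous_intros)
      (use that in auto)
  \<comment> \<open>The sum is bracketed to the right like the joins in
    \<open>rect_boundary\<close>, so the join rule applies structurally. The top and left edges run
    backwards and carry the minus signs.\<close>
  have "has_line_integral M N (rect_boundary a1 b1 a2 b2)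
     (integral {a1..b1} (\<lambda>x. M (x, a2)) + (integral {a2..b2} (\<lambda>y. N (b1, y))
      + (- integral {a1..b1} (\<lambda>x. M (x, b2)) + - integral {a2..b2} (\<lambda>y. N (a1, y)))))"
    unfolding rect_boundary_def
    by (intro has_line_integral_join has_line_integral_horizontal has_line_integral_vertical
        M' N' valid_path_join valid_path_linepath) (use ab in auto)
  from line_integral_eqI[OF this] show ?thesis by simp
qed

subsection \<open>Green-type formula\<close>

text \<open>Passing through the double integral relates both orders. The formula has t2 innermost,
  while integration by parts in t1 calls for t1 innermost.\<close>

lemma integral_cbox_iterated:
  fixes F :: "real \<times> real \<Rightarrow> real"
  assumes "continuous_on ({a1..b1} \<times> {a2..b2}) F"
  shows "integral {a1..b1} (\<lambda>x. integral {a2..b2} (\<lambda>y. F (x, y))) = integral (cbox (a1, a2) (b1, b2)) F"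
    and "integral {a2..b2} (\<lambda>y. integral {a1..b1} (\<lambda>x. F (x, y))) = integral (cbox (a1, a2) (b1, b2)) F"
proof -
  have F: "continuous_on (cbox (a1, a2) (b1, b2)) F"
    using assms by (simp add: cbox_Pair_eq)
  show "integral {a1..b1} (\<lambda>x. integral {a2..b2} (\<lambda>y. F (x, y))) = integral (cbox (a1, a2) (b1, b2)) F"
    using integral_prod_continuous[OF F] by simp
  moreover have "continuous_on (cbox (a1, a2) (b1, b2)) (\<lambda>(x, y). F (x, y))"
    using F by simp
  ultimately show "integral {a2..b2} (\<lambda>y. integral {a1..b1} (\<lambda>x. F (x, y))) = integral (cbox (a1, a2) (b1, b2)) F"
    using integral_swap_continuous[of a1 a2 b1 b2 "\<lambda>x y. F (x, y)"] by simp
qed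

theorem theorem3p2:
  fixes \<alpha> a1 b1 a2 b2 p1 q1 p2 q2 :: real
    and f g \<eta> :: "real \<times> real \<Rightarrow> real"
    and k :: "real \<Rightarrow> real \<Rightarrow> real"
    and \<Delta> :: "(real \<times> real) set"
    and P1 P2 :: param_set
  assumes "0 < \<alpha>" and "\<alpha> < 1"
    and "a1 < b1" and "a2 < b2"
    and "\<Delta> = {a1..b1} \<times> {a2..b2}"
    and "P1 = Param a1 b1 p1 q1" and "P2 = Param a2 b2 p2 q2"
    and "C1_on \<Delta> f" and "C1_on \<Delta> g" and "C1_on \<Delta> \<eta>"
    and "k (1 - \<alpha>) absolutely_integrable_on {0..b1 - a1}"
    and "k (1 - \<alpha>) absolutely_integrable_on {0..b2 - a2}"
    and "C1_on \<Delta> (K1 k (1 - \<alpha>) (dual P1) g)"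
    and "C1_on \<Delta> (K2 k (1 - \<alpha>) (dual P2) f)"
  shows "integral {a1..b1} (\<lambda>t1. integral {a2..b2} (\<lambda>t2.
             g (t1, t2) * B1 k \<alpha> P1 \<eta> (t1, t2) + f (t1, t2) * B2 k \<alpha> P2 \<eta> (t1, t2)))
       = - integral {a1..b1} (\<lambda>t1. integral {a2..b2} (\<lambda>t2.
             \<eta> (t1, t2) * (A1 k \<alpha> (dual P1) g (t1, t2) + A2 k \<alpha> (dual P2) f (t1, t2))))
         + line_integral (\<lambda>t. - (\<eta> t * K2 k (1 - \<alpha>) (dual P2) f t))
                         (\<lambda>t. \<eta> t * K1 k (1 - \<alpha>) (dual P1) g t)
                         (rect_boundary a1 b1 a2 b2)"
proof -
  note \<Delta> = \<open>\<Delta> = _\<close>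
  let ?R = "cbox (a1, a2) (b1, b2)"
  let ?K1 = "K1 k (1 - \<alpha>) (dual P1) g" and ?K2 = "K2 k (1 - \<alpha>) (dual P2) f"
  let ?A1 = "A1 k \<alpha> (dual P1) g" and ?A2 = "A2 k \<alpha> (dual P2) f"
  let ?B1 = "B1 k \<alpha> P1 \<eta>" and ?B2 = "B2 k \<alpha> P2 \<eta>"
  have R: "\<Delta> = ?R"
    by (simp add: \<Delta> cbox_Pair_eq)
  note C1 = \<open>C1_on \<Delta> f\<close> \<open>C1_on \<Delta> g\<close> \<open>C1_on \<Delta> \<eta>\<close> \<open>C1_on \<Delta> ?K1\<close> \<open>C1_on \<Delta> ?K2\<close>
  note cont = C1[THEN C1_on_continuous_on]
  note parts1 = B1_by_parts[of a1 b1 k \<alpha> "{a2..b2}" P1 p1 q1 g \<eta>]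
  note parts2 = B2_by_parts[of a2 b2 k \<alpha> "{a1..b1}" P2 p2 q2 f \<eta>]
  have cB: "continuous_on \<Delta> ?B1" "continuous_on \<Delta> ?B2"
    and cA: "continuous_on \<Delta> ?A1" "continuous_on \<Delta> ?A2"
    using parts1(1,2) parts2(1,2) assms cont by simp_all
  have slice1: "continuous_on {a1..b1} (\<lambda>x. F (x, y))"
    if "continuous_on \<Delta> F" "y \<in> {a2..b2}" for F :: "real \<times> real \<Rightarrow> real" and y
    by (intro continuous_on_compose2[OF that(1)] continuous_intros) (use that(2) in \<open>auto simp: \<Delta>\<close>)
  have slice2: "continuous_on {a2..b2} (\<lambda>y. F (x, y))"
    if "continuous_on \<Delta> F" "x \<in> {a1..b1}" for F :: "real \<times> real \<Rightarrow> real" and x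
    by (intro continuous_on_compose2[OF that(1)] continuous_intros) (use that(2) in \<open>auto simp: \<Delta>\<close>)
  \<comment> \<open>The last two facts give integrability in the outer variable, which is needed to
    split the outer integral after integration by parts.\<close>
  have iter: "integral {a1..b1} (\<lambda>x. integral {a2..b2} (\<lambda>y. F (x, y))) = integral ?R F"
      "integral {a2..b2} (\<lambda>y. integral {a1..b1} (\<lambda>x. F (x, y))) = integral ?R F"
      "F integrable_on ?R"
      "(\<lambda>x. integral {a2..b2} (\<lambda>y. F (x, y))) integrable_on {a1..b1}"
      "(\<lambda>y. integral {a1..b1} (\<lambda>x. F (x, y))) integrable_on {a2..b2}"
    if "continuous_on \<Delta> F" for F :: "real \<times> real \<Rightarrow> real"
  proof -
    show "integral {a1..b1} (\<lambda>x. integral {a2..b2} (\<lambda>y. F (x, y))) = integral ?R F"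
      "integral {a2..b2} (\<lambda>y. integral {a1..b1} (\<lambda>x. F (x, y))) = integral ?R F"
      using integral_cbox_iterated[of a1 b1 a2 b2 F] that by (simp_all add: \<Delta>)
    show "F integrable_on ?R"
      using that unfolding R by (rule integrable_continuous)
    show "(\<lambda>x. integral {a2..b2} (\<lambda>y. F (x, y))) integrable_on {a1..b1}"
      using integral_integrable_2dim[of a1 a2 b1 b2 F] that unfolding R by (simp add: case_prod_beta)
    have "continuous_on (cbox (a2, a1) (b2, b1)) (\<lambda>z. F (prod.swap z))"
      using that continuous_on_swap_iff[of "{a1..b1}" "{a2..b2}" F] by (simp add: \<Delta> o_def cbox_Pair_eq)
    from integral_integrable_2dim[OF this]
    show "(\<lambda>y. integral {a1..b1} (\<lambda>x. F (x, y))) integrable_on {a2..b2}"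
      by simp
  qed
  have c1: "continuous_on \<Delta> (\<lambda>t. g t * ?B1 t)" "continuous_on \<Delta> (\<lambda>t. f t * ?B2 t)"
    "continuous_on \<Delta> (\<lambda>t. \<eta> t * ?A1 t)" "continuous_on \<Delta> (\<lambda>t. \<eta> t * ?A2 t)"
    "continuous_on \<Delta> (\<lambda>t. \<eta> t * ?K1 t)" "continuous_on \<Delta> (\<lambda>t. \<eta> t * ?K2 t)"
    by (intro continuous_intros cont cA cB)+
  \<comment> \<open>\<open>?b1 x\<close> is the unsigned contribution of the edge t1 = x, and
    \<open>?b2 y\<close> that of the edge t2 = y.\<close>
  let ?b1 = "\<lambda>x. integral {a2..b2} (\<lambda>y. \<eta> (x, y) * ?K1 (x, y))"
  let ?b2 = "\<lambda>y. integral {a1..b1} (\<lambda>x. \<eta> (x, y) * ?K2 (x, y))"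
  have i1: "(\<lambda>y. \<eta> (x, y) * ?K1 (x, y)) integrable_on {a2..b2}" if "x \<in> {a1..b1}" for x
    using slice2[OF c1(5) that] by (intro integrable_continuous_real)
  have i2: "(\<lambda>x. \<eta> (x, y) * ?K2 (x, y)) integrable_on {a1..b1}" if "y \<in> {a2..b2}" for y
    using slice1[OF c1(6) that] by (intro integrable_continuous_real)
  \<comment> \<open>\<open>B1\<close> acts in t1, so t1 is made the inner variable; integration by
    parts for each fixed \<open>y\<close> then leaves the two vertical edges.\<close>
  have "integral ?R (\<lambda>t. g t * ?B1 t) = integral {a2..b2} (\<lambda>y. integral {a1..b1} (\<lambda>x. g (x, y) * ?B1 (x, y)))"
    using iter(2)[OF c1(1)] by simp
  also have "\<dots> = integral {a2..b2} (\<lambda>y. \<eta> (b1, y) * ?K1 (b1, y) - \<eta> (a1, y) * ?K1 (a1, y)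
      - integral {a1..b1} (\<lambda>x. \<eta> (x, y) * ?A1 (x, y)))"
    using parts1(3) assms cont by (intro Henstock_Kurzweil_Integration.integral_cong) simp
  also have "\<dots> = ?b1 b1 - ?b1 a1 - integral ?R (\<lambda>t. \<eta> t * ?A1 t)"
    using i1[of a1] i1[of b1] iter(2,5)[OF c1(3)] assms(3)
    by (simp add: Henstock_Kurzweil_Integration.integral_diff integrable_diff)
  finally have 1: "integral ?R (\<lambda>t. g t * ?B1 t) = ?b1 b1 - ?b1 a1 - integral ?R (\<lambda>t. \<eta> t * ?A1 t)" .
  \<comment> \<open>\<open>B2\<close> acts in t2, so here t2 is the inner variable and the two
    horizontal edges remain.\<close>
  have "integral ?R (\<lambda>t. f t * ?B2 t) = integral {a1..b1} (\<lambda>x. integral {a2..b2} (\<lambda>y. f (x, y) * ?B2 (x, y)))"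
    using iter(1)[OF c1(2)] by simp
  also have "\<dots> = integral {a1..b1} (\<lambda>x. \<eta> (x, b2) * ?K2 (x, b2) - \<eta> (x, a2) * ?K2 (x, a2)
      - integral {a2..b2} (\<lambda>y. \<eta> (x, y) * ?A2 (x, y)))"
    using parts2(3) assms cont by (intro Henstock_Kurzweil_Integration.integral_cong) simp
  also have "\<dots> = ?b2 b2 - ?b2 a2 - integral ?R (\<lambda>t. \<eta> t * ?A2 t)"
    using i2[of a2] i2[of b2] iter(1,4)[OF c1(4)] assms(4)
    by (simp add: Henstock_Kurzweil_Integration.integral_diff integrable_diff)
  finally have 2: "integral ?R (\<lambda>t. f t * ?B2 t) = ?b2 b2 - ?b2 a2 - integral ?R (\<lambda>t. \<eta> t * ?A2 t)" .
  have "integral {a1..b1} (\<lambda>x. integral {a2..b2} (\<lambda>y. g (x, y) * ?B1 (x, y) + f (x, y) * ?B2 (x, y)))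
      = integral ?R (\<lambda>t. g t * ?B1 t + f t * ?B2 t)"
    by (rule iter(1)) (intro continuous_on_add c1)
  also have "\<dots> = integral ?R (\<lambda>t. g t * ?B1 t) + integral ?R (\<lambda>t. f t * ?B2 t)"
    by (intro Henstock_Kurzweil_Integration.integral_add iter(3) c1)
  finally have L: "integral {a1..b1} (\<lambda>x. integral {a2..b2} (\<lambda>y. g (x, y) * ?B1 (x, y) + f (x, y) * ?B2 (x, y)))
      = integral ?R (\<lambda>t. g t * ?B1 t) + integral ?R (\<lambda>t. f t * ?B2 t)" .
  have "integral {a1..b1} (\<lambda>x. integral {a2..b2} (\<lambda>y. \<eta> (x, y) * (?A1 (x, y) + ?A2 (x, y))))
      = integral ?R (\<lambda>t. \<eta> t * (?A1 t + ?A2 t))"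
    by (rule iter(1)) (intro continuous_intros cont cA)
  also have "\<dots> = integral ?R (\<lambda>t. \<eta> t * ?A1 t) + integral ?R (\<lambda>t. \<eta> t * ?A2 t)"
    unfolding distrib_left by (intro Henstock_Kurzweil_Integration.integral_add iter(3) c1)
  finally have A: "integral {a1..b1} (\<lambda>x. integral {a2..b2} (\<lambda>y. \<eta> (x, y) * (?A1 (x, y) + ?A2 (x, y))))
      = integral ?R (\<lambda>t. \<eta> t * ?A1 t) + integral ?R (\<lambda>t. \<eta> t * ?A2 t)" .
  \<comment> \<open>Counterclockwise orientation and the sign in front of \<open>?K2\<close> give
    the bottom edge a minus and the top edge a plus, as in the boundary terms of \<open>2\<close>;
    the vertical edges match those of \<open>1\<close>.\<close>
  have "line_integral (\<lambda>t. - (\<eta> t * ?K2 t)) (\<lambda>t. \<eta> t * ?K1 t) (rect_boundary a1 b1 a2 b2)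
      = ?b2 b2 - ?b2 a2 + ?b1 b1 - ?b1 a1"
    using line_integral_rect_boundary[OF \<open>a1 < b1\<close> \<open>a2 < b2\<close>, of "\<lambda>t. - (\<eta> t * ?K2 t)" "\<lambda>t. \<eta> t * ?K1 t"]
      c1(5,6) by (simp add: \<Delta> continuous_on_minus)
  then show ?thesis
    unfolding L A 1 2 by simp
qed

end
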